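(* Let $T(z)$ be the formal power series with $T(z)=1+zT(z)^3$, $T(0)=1$, and let $X=X(z)$ be the unique formal power series with $X(0)=0$ satisfying $X=zT^2X\left(\frac1X+1+X\right)$. Then $X$ also satisfies $X=z\frac{(1+X+X^2)^3}{(1+X^2)^2}$ and $T=\frac{1+X+X^2}{1+X^2}$; $X$ has non-negative coefficients and $$X=\frac{1-zT^2-\sqrt{1-2zT^2-3z^2T^4}}{2zT^2}=\frac{1-\sqrt{1-4\tilde T^2}}{2\tilde T},\qquad \tilde T=T-1.$$ Moreover, for $j\ge -1$, the generating function $T_j(z)$ of naturally embedded ternary trees with no label greater than $j$ is $$T_j(z)=T(z)\,\frac{(1-X^{j+2}(z))(1-X^{j+5}(z))}{(1-X^{j+3}(z))(1-X^{j+4}(z))}.$$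
   Context: A ternary tree is either an external node (leaf) or an internal node with three ordered subtrees (left, center, right); size = number of internal nodes, and $T(z)=\sum_n T_nz^n$ counts ternary trees by size. In the natural embedding the root has label $0$ and the left, center, right children of a node with label $j\in\mathbb{Z}$ have labels $j-1,j,j+1$. $T_j(z)$ is the generating function, by size, of ternary trees in which no internal node has label greater than $j$ (so $T_{-1}(z)=1$). *)

theory Defs
  imports Complex_Main "HOL-Computational_Algebra.Formal_Laurent_Series"
begin

datatype ternary = Leaf | Node ternary ternary ternary

fun internal_nodes :: "ternary \<Rightarrow> nat" where
  "internal_nodes Leaf = 0"
| "internal_nodes (Node l c r) = 1 + internal_nodes l + internal_nodes c + internal_nodes r"

text \<open>The set of labels of the internal nodes when the root carries label \<open>i\<close>;
  the natural embedding is the case \<open>i = 0\<close>.\<close>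

fun internal_labels :: "int \<Rightarrow> ternary \<Rightarrow> int set" where
  "internal_labels i Leaf = {}"
| "internal_labels i (Node l c r) =
     {i} \<union> internal_labels (i - 1) l \<union> internal_labels i c \<union> internal_labels (i + 1) r"

definition ternary_gf :: "real fps" where
  "ternary_gf = Abs_fps (\<lambda>n. of_nat (card {t. internal_nodes t = n}))"

definition bounded_ternary_gf :: "int \<Rightarrow> real fps" where
  "bounded_ternary_gf j =
     Abs_fps (\<lambda>n. of_nat (card {t. internal_nodes t = n \<and> (\<forall>i \<in> internal_labels 0 t. i \<le> j)}))"

definition is_T :: "real fps \<Rightarrow> bool" where
  "is_T T \<longleftrightarrow> T = 1 + fps_X * T ^ 3 \<and> fps_nth T 0 = 1"

text \<open>The defining equation \<open>X = z T\<^sup>2 X (1/X + 1 + X)\<close> involves \<open>1/X\<close>, where \<open>X\<close> has constant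
  term \<open>0\<close>, so it is read in the field of formal Laurent series. For \<open>1/X\<close> to make sense, \<open>X\<close>
  must be nonzero; this has to be said explicitly, because the convention \<open>1/0 = 0\<close> would
  otherwise admit the spurious solution \<open>X = 0\<close>.\<close>

definition is_X :: "real fps \<Rightarrow> real fps \<Rightarrow> bool" where
  "is_X T X \<longleftrightarrow>
     fps_nth X 0 = 0 \<and> X \<noteq> 0 \<and>
     fps_to_fls X =
       fps_to_fls (fps_X * T ^ 2) * fps_to_fls X * (1 / fps_to_fls X + 1 + fps_to_fls X)"

text \<open>The square root with constant term \<open>1\<close> of a series with constant term \<open>1\<close>.\<close>

definition fps_sqrt :: "real fps \<Rightarrow> real fps" where
  "fps_sqrt f = fps_radical root 2 f"

end

theory Submission
  imports Defs
begin

text \<open>Put \<open>w = z T\<^sup>2\<close>. Then \<open>X\<close> is the power series root of \<open>X = w (1 + X + X\<^sup>2)\<close>;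
  multiplying by \<open>T\<close> and using \<open>w T = T - 1\<close> gives \<open>T (1 + X\<^sup>2) = 1 + X + X\<^sup>2\<close>.
  Decomposing a tree at its root and shifting labels yields
  \<open>T\<^sub>j = 1 + z T\<^sub>j\<^sub>+\<^sub>1 T\<^sub>j T\<^sub>j\<^sub>-\<^sub>1\<close> for \<open>j \<ge> 0\<close>, with \<open>T\<^sub>-\<^sub>1 = 1\<close>. This system
  determines all coefficients, and the product formula solves it: in
  \<open>T\<^sub>j\<^sub>+\<^sub>1 T\<^sub>j T\<^sub>j\<^sub>-\<^sub>1\<close> most factors cancel, which leaves a polynomial identity in
  \<open>X\<close> and \<open>X\<^sup>j\<close>.\<close>

section \<open>Counting series\<close>

text \<open>The set and the size function are arguments so that one product rule covers trees and
  tuples of trees alike. Since \<open>card\<close> of an infinite set is 0, the series is meaningful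
  only when every size class is finite.\<close>

definition counting_series :: "('a \<Rightarrow> nat) \<Rightarrow> 'a set \<Rightarrow> real fps" where
  "counting_series f A = Abs_fps (\<lambda>n. of_nat (card {x \<in> A. f x = n}))"

lemma counting_series_nth: "fps_nth (counting_series f A) n = of_nat (card {x \<in> A. f x = n})"
  by (simp add: counting_series_def)

lemma counting_series_Times:
  fixes f :: "'a \<Rightarrow> nat" and g :: "'b \<Rightarrow> nat"
  assumes "\<And>n. finite {x \<in> A. f x = n}" "\<And>n. finite {y \<in> B. g y = n}"
  shows "counting_series (\<lambda>(x, y). f x + g y) (A \<times> B) = counting_series f A * counting_series g B"
proof (rule fps_ext)
  fix n
  have eq: "{p \<in> A \<times> B. (\<lambda>(x, y). f x + g y) p = n} =
      (\<Union>i\<in>{0..n}. {x \<in> A. f x = i} \<times> {y \<in> B. g y = n - i})"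
    by auto
  have "card {p \<in> A \<times> B. (\<lambda>(x, y). f x + g y) p = n} =
      (\<Sum>i\<in>{0..n}. card ({x \<in> A. f x = i} \<times> {y \<in> B. g y = n - i}))"
    unfolding eq by (rule card_UN_disjoint) (use assms in auto)
  then show "fps_nth (counting_series (\<lambda>(x, y). f x + g y) (A \<times> B)) n =
      fps_nth (counting_series f A * counting_series g B) n"
    by (simp add: counting_series_nth fps_mult_nth card_cartesian_product)
qed

text \<open>Bounding the size by \<open>n\<close> instead of fixing it lets a single induction
  hypothesis cover all three subtrees, whatever their individual sizes.\<close>

lemma finite_internal_nodes_le: "finite {t. internal_nodes t \<le> n}"
proof (induction n)
  case 0
  have "{t. internal_nodes t \<le> 0} \<subseteq> {Leaf}"
  proof
    fix t assume "t \<in> {t. internal_nodes t \<le> 0}"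
    then show "t \<in> {Leaf}" by (cases t) auto
  qed
  then show ?case by (rule finite_subset) simp
next
  case (Suc n)
  let ?S = "{t. internal_nodes t \<le> n}"
  have "{t. internal_nodes t \<le> Suc n} \<subseteq> insert Leaf ((\<lambda>(l, c, r). Node l c r) ` (?S \<times> ?S \<times> ?S))"
  proof
    fix t assume "t \<in> {t. internal_nodes t \<le> Suc n}"
    then show "t \<in> insert Leaf ((\<lambda>(l, c, r). Node l c r) ` (?S \<times> ?S \<times> ?S))"
      by (cases t) force+
  qed
  then show ?case by (rule finite_subset) (use Suc in auto)
qed

lemma finite_internal_nodes_eq: "finite {t \<in> A. internal_nodes t = n}"
  by (rule finite_subset[OF _ finite_internal_nodes_le[of n]]) auto

text \<open>Three separate classes are needed for the subtrees: a fixed bound on the labels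
  restricts the left, center and right subtrees differently.\<close>

lemma counting_series_root_decomposition:
  assumes "\<And>l c r. Node l c r \<in> S \<longleftrightarrow> l \<in> A \<and> c \<in> B \<and> r \<in> C" and "Leaf \<in> S"
  shows "counting_series internal_nodes S =
    1 + fps_X * (counting_series internal_nodes A * counting_series internal_nodes B *
                 counting_series internal_nodes C)"
    (is "?L = 1 + fps_X * ?R")
proof (rule fps_ext)
  fix n
  let ?g = "\<lambda>(c, r). internal_nodes c + internal_nodes r"
  let ?f = "\<lambda>(l, p). internal_nodes l + ?g p"
  let ?N = "\<lambda>(l, c, r). Node l c r"
  have fin: "finite {p \<in> B \<times> C. ?g p = n}" for n
    by (rule finite_subset[of _ "{t. internal_nodes t \<le> n} \<times> {t. internal_nodes t \<le> n}"])
      (auto simp: finite_internal_nodes_le)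
  have "counting_series ?f (A \<times> B \<times> C) =
      counting_series internal_nodes A * counting_series ?g (B \<times> C)"
    by (rule counting_series_Times) (rule finite_internal_nodes_eq fin)+
  also have "counting_series ?g (B \<times> C) =
      counting_series internal_nodes B * counting_series internal_nodes C"
    by (rule counting_series_Times) (rule finite_internal_nodes_eq)+
  finally have R: "?R = counting_series ?f (A \<times> B \<times> C)" by (simp add: mult.assoc)
  show "fps_nth ?L n = fps_nth (1 + fps_X * ?R) n"
  proof (cases n)
    case 0
    have "t = Leaf" if "internal_nodes t = 0" for t using that by (cases t) auto
    then have "{t \<in> S. internal_nodes t = 0} = {Leaf}" using assms(2) by auto
    then show ?thesis by (simp add: 0 counting_series_nth)
  next
    case (Suc m)
    have "bij_betw ?N {p \<in> A \<times> B \<times> C. ?f p = m} {t \<in> S. internal_nodes t = Suc m}"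
    proof (rule bij_betw_imageI)
      show "inj_on ?N {p \<in> A \<times> B \<times> C. ?f p = m}" by (auto simp: inj_on_def)
      show "?N ` {p \<in> A \<times> B \<times> C. ?f p = m} = {t \<in> S. internal_nodes t = Suc m}"
      proof (intro equalityI subsetI)
        fix t assume "t \<in> ?N ` {p \<in> A \<times> B \<times> C. ?f p = m}"
        then show "t \<in> {t \<in> S. internal_nodes t = Suc m}" using assms(1) by auto
      next
        fix t assume t: "t \<in> {t \<in> S. internal_nodes t = Suc m}"
        then obtain l c r where "t = Node l c r" by (cases t) auto
        with t show "t \<in> ?N ` {p \<in> A \<times> B \<times> C. ?f p = m}"
          using assms(1) by (intro image_eqI[of _ _ "(l, c, r)"]) auto
      qed
    qed
    from bij_betw_same_card[OF this] show ?thesis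
      by (simp add: Suc R counting_series_nth)
  qed
qed

section \<open>Functional equations for ternary trees and for trees with bounded labels\<close>

lemma ternary_gf_eq: "ternary_gf = 1 + fps_X * ternary_gf ^ 3"
proof -
  have "ternary_gf = counting_series internal_nodes UNIV"
    by (simp add: ternary_gf_def counting_series_def)
  then show ?thesis
    using counting_series_root_decomposition[of UNIV UNIV UNIV UNIV]
    by (simp add: power3_eq_cube)
qed

lemma internal_labels_shift: "internal_labels (i + k) t = (\<lambda>x. x + k) ` internal_labels i t"
proof (induction t arbitrary: i)
  case (Node l c r)
  have "i + k - 1 = i - 1 + k" "i + k + 1 = i + 1 + k" by simp_all
  then show ?case by (simp only: internal_labels.simps Node.IH image_Un) simp
qed simp

text \<open>Moving the root label and the bound together changes nothing. Hence subtrees rooted at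
  -1, 0 and 1 under the common bound \<open>j\<close> are counted with the bounds
  \<open>j + 1\<close>, \<open>j\<close> and \<open>j - 1\<close>.\<close>

lemma bounded_ternary_gf_eq_counting_series:
  "bounded_ternary_gf j =
     counting_series internal_nodes {t. \<forall>i \<in> internal_labels k t. i \<le> j + k}"
proof -
  have "(\<forall>i \<in> internal_labels k t. i \<le> j + k) \<longleftrightarrow> (\<forall>i \<in> internal_labels 0 t. i \<le> j)" for t
    using internal_labels_shift[of 0 k t] by simp
  then show ?thesis
    by (simp add: bounded_ternary_gf_def counting_series_def conj_commute)
qed

lemma bounded_ternary_gf_minus_one: "bounded_ternary_gf (-1) = 1"
proof (rule fps_ext)
  fix n
  have "(\<forall>i \<in> internal_labels 0 t. i \<le> -1) \<longleftrightarrow> t = Leaf" for t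
    by (cases t) auto
  then have "{t. internal_nodes t = n \<and> (\<forall>i \<in> internal_labels 0 t. i \<le> -1)} =
      (if n = 0 then {Leaf} else {})" by auto
  then show "fps_nth (bounded_ternary_gf (-1)) n = fps_nth 1 n"
    by (simp add: bounded_ternary_gf_def)
qed

lemma bounded_ternary_gf_rec:
  assumes "j \<ge> 0"
  shows "bounded_ternary_gf j =
    1 + fps_X * (bounded_ternary_gf (j + 1) * bounded_ternary_gf j * bounded_ternary_gf (j - 1))"
proof -
  let ?S = "\<lambda>k. {t. \<forall>i \<in> internal_labels k t. i \<le> j}"
  have "counting_series internal_nodes (?S 0) =
    1 + fps_X * (counting_series internal_nodes (?S (-1)) * counting_series internal_nodes (?S 0) *
                 counting_series internal_nodes (?S 1))"
    by (rule counting_series_root_decomposition) (use assms in auto)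
  then show ?thesis
    using bounded_ternary_gf_eq_counting_series[of j 0]
      bounded_ternary_gf_eq_counting_series[of "j + 1" "-1"]
      bounded_ternary_gf_eq_counting_series[of "j - 1" 1] by simp
qed

section \<open>Power series equations\<close>

text \<open>Trades a quotient with invertible denominator for a product, so that the remaining work
  is polynomial algebra.\<close>

lemma fps_eq_divide_unit_iff:
  fixes a b c :: "real fps"
  assumes "fps_nth b 0 \<noteq> 0"
  shows "a = c / b \<longleftrightarrow> a * b = c"
proof -
  from assms have "b \<noteq> 0" "b dvd c" by (auto simp: fps_is_unit_iff unit_imp_dvd)
  then show ?thesis by auto
qed

text \<open>Serves denominators with constant term 0, such as \<open>2 * fps_X * T ^ 2\<close>,
  which are invertible only among Laurent series.\<close>

lemma fps_to_fls_eq_divide: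
  fixes a b c :: "'a :: field fps"
  assumes "a * b = c" "b \<noteq> 0"
  shows "fps_to_fls a = fps_to_fls c / fps_to_fls b"
  using assms(2) by (simp add: fls_times_fps_to_fls flip: assms(1))

lemma fps_sqrt_square:
  assumes "fps_nth f 0 = 1"
  shows "fps_sqrt f ^ 2 = f" "fps_nth (fps_sqrt f) 0 = 1"
  using power_radical[of f root 1] assms
  by (simp_all add: fps_sqrt_def numeral_2_eq_2)

lemma fps_sqrt_eqI:
  assumes "g ^ 2 = f" "fps_nth g 0 = 1"
  shows "fps_sqrt f = g"
proof -
  have f0: "fps_nth f 0 = 1" using assms by (auto simp: power2_eq_square)
  have "(fps_sqrt f - g) * (fps_sqrt f + g) = fps_sqrt f ^ 2 - g ^ 2"
    by (simp add: algebra_simps power2_eq_square)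
  also have "\<dots> = 0" using fps_sqrt_square(1)[OF f0] assms(1) by simp
  finally have "(fps_sqrt f - g) * (fps_sqrt f + g) = 0" .
  moreover have "fps_nth (fps_sqrt f + g) 0 \<noteq> 0"
    using fps_sqrt_square(2)[OF f0] assms(2) by simp
  ultimately show ?thesis by (metis eq_iff_diff_eq_0 fps_zero_nth mult_eq_0_iff)
qed

section \<open>Existence, uniqueness and positivity of the solutions T and X\<close>

lemma is_T_unique:
  assumes "is_T S" "is_T T"
  shows "S = T"
proof -
  have "S = 1 + fps_X * S ^ 3" "T = 1 + fps_X * T ^ 3" using assms by (simp_all add: is_T_def)
  then have "(S - T) * (1 - fps_X * (S ^ 2 + S * T + T ^ 2)) = 0" by algebra
  \<comment> \<open>The cofactor has constant term 1, so it is nonzero and cancels in the integral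
    domain of power series.\<close>
  moreover have "fps_nth (1 - fps_X * (S ^ 2 + S * T + T ^ 2)) 0 \<noteq> 0" by simp
  ultimately show ?thesis by (metis eq_iff_diff_eq_0 fps_zero_nth mult_eq_0_iff)
qed

lemma is_T_ternary_gf: "is_T ternary_gf"
proof -
  have "fps_nth ternary_gf 0 = 1" by (subst ternary_gf_eq) simp
  then show ?thesis using ternary_gf_eq by (simp add: is_T_def)
qed

text \<open>Cancelling X against 1/X leaves a quadratic equation between power series. It excludes X
  = 0 by itself, since its right-hand side would then be \<open>fps_X * T ^ 2\<close>, which is
  nonzero.\<close>

lemma is_X_iff:
  assumes "is_T T"
  shows "is_X T X \<longleftrightarrow> fps_nth X 0 = 0 \<and> X = fps_X * T ^ 2 * (1 + X + X ^ 2)"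
proof -
  let ?w = "fps_X * T ^ 2"
  have T0: "T \<noteq> 0" using assms by (auto simp: is_T_def)
  have eq: "fps_to_fls X = fps_to_fls ?w * fps_to_fls X * (1 / fps_to_fls X + 1 + fps_to_fls X)
      \<longleftrightarrow> X = ?w * (1 + X + X ^ 2)" if "X \<noteq> 0"
  proof -
    have "fps_to_fls ?w * fps_to_fls X * (1 / fps_to_fls X + 1 + fps_to_fls X) =
        fps_to_fls ?w * (1 + fps_to_fls X + fps_to_fls X ^ 2)"
      using that by (simp add: field_simps power2_eq_square)
    also have "\<dots> = fps_to_fls (?w * (1 + X + X ^ 2))"
      by (simp only: fls_times_fps_to_fls fps_to_fls_plus fps_to_fls_power fps_one_to_fls)
    finally show ?thesis by (simp only: fps_to_fls_eq_iff)
  qed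
  have "X \<noteq> 0" if "X = ?w * (1 + X + X ^ 2)" using that T0 by auto
  then show ?thesis using eq by (auto simp: is_X_def)
qed

lemma is_X_unique:
  assumes "is_T T" "is_X T X" "is_X T Y"
  shows "X = Y"
proof -
  have "X = fps_X * T ^ 2 * (1 + X + X ^ 2)" "Y = fps_X * T ^ 2 * (1 + Y + Y ^ 2)"
    using assms is_X_iff by blast+
  then have "(X - Y) * (1 - fps_X * (T ^ 2 * (1 + X + Y))) = 0" by algebra
  moreover have "fps_nth (1 - fps_X * (T ^ 2 * (1 + X + Y))) 0 \<noteq> 0" by simp
  ultimately show ?thesis by (metis eq_iff_diff_eq_0 fps_zero_nth mult_eq_0_iff)
qed

lemma is_X_exists:
  assumes "is_T T"
  shows "\<exists>X. is_X T X"
proof -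
  define w where "w = fps_X * T ^ 2"
  define s where "s = fps_sqrt (1 - 2 * w - 3 * w ^ 2)"
  have w0: "fps_nth w 0 = 0" by (simp add: w_def)
  then have "fps_nth (1 - 2 * w - 3 * w ^ 2) 0 = 1" by (simp add: power2_eq_square)
  then have s: "s ^ 2 = 1 - 2 * w - 3 * w ^ 2" "fps_nth s 0 = 1"
    unfolding s_def by (rule fps_sqrt_square)+
  define d where "d = 1 - w + s"
  have d0: "fps_nth d 0 \<noteq> 0" using s w0 by (simp add: d_def)
  \<comment> \<open>Rationalised quadratic formula: dividing by the unit \<open>d\<close> instead of by \<open>2 w\<close>.\<close>
  define X where "X = 2 * w / d"
  have Xd: "X * d = 2 * w" using fps_eq_divide_unit_iff[OF d0] X_def by blast
  have "(X - w * (1 + X + X ^ 2)) * d ^ 2 = 0"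
    using Xd s(1) unfolding d_def by algebra
  moreover have "d ^ 2 \<noteq> 0" using d0 by auto
  ultimately have "X = w * (1 + X + X ^ 2)" by simp
  moreover from this have "fps_nth X 0 = 0" using w0 by (metis fps_mult_nth_0 mult_zero_left)
  ultimately show ?thesis using is_X_iff[OF assms] by (auto simp: w_def)
qed

lemma fps_mult_nth_nonneg:
  fixes f g :: "real fps"
  assumes "\<And>i. i \<le> n \<Longrightarrow> fps_nth f i \<ge> 0" "\<And>i. i \<le> n \<Longrightarrow> fps_nth g i \<ge> 0"
  shows "fps_nth (f * g) n \<ge> 0"
  using assms by (auto simp: fps_mult_nth intro!: sum_nonneg)

text \<open>The factor \<open>fps_X\<close> expresses coefficient n of X through earlier
  coefficients of X and coefficients of T. The latter are nonnegative because T, being unique, is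
  the series counting ternary trees.\<close>

lemma is_X_nonneg:
  assumes "is_T T" "is_X T X"
  shows "fps_nth X n \<ge> 0"
proof (induction n rule: less_induct)
  case (less n)
  have X: "fps_nth X 0 = 0" "X = fps_X * (T ^ 2 * (1 + X + X ^ 2))"
    using assms is_X_iff[of T X] by (simp_all add: mult.assoc)
  have T: "fps_nth T k \<ge> 0" for k
    using is_T_unique[OF assms(1) is_T_ternary_gf] by (simp add: ternary_gf_def)
  show ?case
  proof (cases n)
    case (Suc m)
    have "fps_nth (X ^ 2) i \<ge> 0" if "i \<le> m" for i
      unfolding power2_eq_square by (rule fps_mult_nth_nonneg) (use less that Suc in auto)
    then have "fps_nth (T ^ 2 * (1 + X + X ^ 2)) m \<ge> 0"
      by (intro fps_mult_nth_nonneg)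
        (use less Suc T in \<open>auto simp: power2_eq_square intro!: fps_mult_nth_nonneg\<close>)
    then show ?thesis by (subst X(2)) (simp add: Suc)
  qed (use X in simp)
qed

lemma is_X_T_mult:
  assumes "is_T T" "is_X T X"
  shows "T * (1 + X ^ 2) = 1 + X + X ^ 2"
proof -
  have "X = fps_X * T ^ 2 * (1 + X + X ^ 2)" "T = 1 + fps_X * T ^ 3"
    using assms is_X_iff[of T X] by (simp_all add: is_T_def)
  then show ?thesis by algebra
qed

text \<open>This is the recurrence with denominators cleared, where Y stands for a power of X.
  Multiplying by \<open>1 + X ^ 2\<close> turns T into \<open>1 + X + X ^ 2\<close> and
  \<open>T - 1\<close> into X, leaving a polynomial identity in X and Y.\<close>

lemma product_formula_identity:
  fixes T X Y :: "'a :: idom"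
  assumes "T * (1 + X ^ 2) = 1 + X + X ^ 2" "1 + X ^ 2 \<noteq> 0"
  shows "T * ((1 - X * Y) * (1 - X ^ 4 * Y)) =
    (1 - X ^ 2 * Y) * (1 - X ^ 3 * Y) + (T - 1) * ((1 - Y) * (1 - X ^ 5 * Y))"
proof -
  have "(1 + X ^ 2) * (T * ((1 - X * Y) * (1 - X ^ 4 * Y))) =
    (1 + X ^ 2) * ((1 - X ^ 2 * Y) * (1 - X ^ 3 * Y) + (T - 1) * ((1 - Y) * (1 - X ^ 5 * Y)))"
    using assms(1) by algebra
  then show ?thesis using assms(2) by simp
qed

section \<open>The product formula\<close>

text \<open>Indices are shifted by one: \<open>F k\<close> plays the role of \<open>T\<^sub>k\<^sub>-\<^sub>1\<close>.\<close>

lemma product_recurrence_unique: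
  fixes F G :: "nat \<Rightarrow> real fps"
  assumes "F 0 = G 0"
    and F: "\<And>k. F (Suc k) = 1 + fps_X * (F (Suc (Suc k)) * F (Suc k) * F k)"
    and G: "\<And>k. G (Suc k) = 1 + fps_X * (G (Suc (Suc k)) * G (Suc k) * G k)"
  shows "F k = G k"
proof -
  have mult_cong: "fps_nth (a * b) n = fps_nth (c * d) n"
    if "\<And>i. i \<le> n \<Longrightarrow> fps_nth a i = fps_nth c i" "\<And>i. i \<le> n \<Longrightarrow> fps_nth b i = fps_nth d i"
    for a b c d :: "real fps" and n
    using that by (simp add: fps_mult_nth)
  have "fps_nth (F k) n = fps_nth (G k) n" for n k
  proof (induction n arbitrary: k rule: less_induct)
    case (less n)
    show ?case
    proof (cases k)
      case 0
      then show ?thesis using assms(1) by simp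
    next
      case (Suc m)
      show ?thesis
      proof (cases n)
        case 0
        then show ?thesis unfolding Suc by (subst F, subst G) simp
      next
        case (Suc p)
        have "fps_nth (F (Suc (Suc m)) * F (Suc m) * F m) p =
            fps_nth (G (Suc (Suc m)) * G (Suc m) * G m) p"
          by (intro mult_cong less) (use Suc in auto)
        then show ?thesis unfolding \<open>k = Suc m\<close> by (subst F, subst G) (simp add: Suc)
      qed
    qed
  qed
  then show ?thesis by (rule fps_ext)
qed

lemma bounded_ternary_gf_formula:
  assumes "is_T T" "is_X T X"
  shows "bounded_ternary_gf (int k - 1) =
    T * (((1 - X ^ (k + 1)) * (1 - X ^ (k + 4))) / ((1 - X ^ (k + 2)) * (1 - X ^ (k + 3))))"
proof -
  have X0: "fps_nth X 0 = 0" using assms(2) by (simp add: is_X_def)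
  \<comment> \<open>The exponent \<open>Suc n\<close> is never 0, so every \<open>u n\<close> has
    constant term 1 and is invertible.\<close>
  define u where "u n = 1 - X ^ Suc n" for n
  have u0: "fps_nth (u n) 0 = 1" for n by (simp add: u_def X0)
  then have u_nz: "u n \<noteq> 0" for n by (metis fps_zero_nth zero_neq_one)
  define F where "F k = T * ((u k * u (k + 3)) / (u (k + 1) * u (k + 2)))" for k
  have F: "F k * (u (k + 1) * u (k + 2)) = T * (u k * u (k + 3))" for k
  proof -
    have "fps_nth (u (k + 1) * u (k + 2)) 0 \<noteq> 0" by (simp add: u0)
    from fps_eq_divide_unit_iff[OF this, THEN iffD1, OF refl] show ?thesis
      by (simp add: F_def mult.assoc)
  qed
  have T: "T = 1 + fps_X * T ^ 3" using assms(1) by (simp add: is_T_def)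
  note TX = is_X_T_mult[OF assms]
  have nz: "1 + X ^ 2 \<noteq> 0"
  proof
    assume "1 + X ^ 2 = 0"
    then have "fps_nth (1 + X ^ 2) 0 = 0" by simp
    then show False by (simp add: power2_eq_square X0)
  qed
  have F_rec: "F (Suc k) = 1 + fps_X * (F (Suc (Suc k)) * F (Suc k) * F k)" for k
  proof -
    define a b c d e f where "a = u k" and "b = u (k + 1)" and "c = u (k + 2)"
      and "d = u (k + 3)" and "e = u (k + 4)" and "f = u (k + 5)"
    note abc = a_def b_def c_def d_def e_def f_def
    have F1: "F k * (b * c) = T * (a * d)" "F (Suc k) * (c * d) = T * (b * e)"
      "F (Suc (Suc k)) * (d * e) = T * (c * f)"
      using F[of k] F[of "Suc k"] F[of "Suc (Suc k)"] by (simp_all add: abc eval_nat_numeral)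
    have id: "T * (b * e) = c * d + (T - 1) * (a * f)"
      using product_formula_identity[OF TX nz, of "X ^ Suc k"]
      by (simp add: abc u_def power_add eval_nat_numeral mult_ac)
    \<comment> \<open>The denominators bc, cd, de multiply to (cd)(bcde) and the numerators ad, be,
      cf to (af)(bcde), so the triple product collapses to \<open>T ^ 3\<close> times
      af/(cd).\<close>
    have "(F (Suc (Suc k)) * F (Suc k) * F k) * (c * d) * (b * c * d * e) =
        (F (Suc (Suc k)) * (d * e)) * (F (Suc k) * (c * d)) * (F k * (b * c))"
      by (simp add: mult_ac)
    also have "\<dots> = T ^ 3 * (a * f) * (b * c * d * e)"
      unfolding F1 by (simp add: mult_ac power3_eq_cube)
    finally have P: "(F (Suc (Suc k)) * F (Suc k) * F k) * (c * d) = T ^ 3 * (a * f)"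
      using u_nz by (simp add: abc)
    \<comment> \<open>Here \<open>id\<close> meets the recurrence through
      \<open>T - 1 = fps_X * T ^ 3\<close>.\<close>
    have "F (Suc k) * (c * d) = (1 + fps_X * (F (Suc (Suc k)) * F (Suc k) * F k)) * (c * d)"
      using F1(2) id P T by algebra
    then show ?thesis using u_nz by (simp add: abc)
  qed
  have F_0: "F 0 = 1"
  proof -
    \<comment> \<open>After multiplication by \<open>1 + X ^ 2\<close> both sides equal (1 - X^2)(1
      - X^3)(1 + X^2), because (1 + X + X^2)(1 - X) = 1 - X^3.\<close>
    have "F 0 * (u 1 * u 2) * (1 + X ^ 2) = 1 * (u 1 * u 2) * (1 + X ^ 2)"
      using F[of 0] TX by (simp add: u_def eval_nat_numeral) algebra
    then show ?thesis using u_nz nz by simp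
  qed
  have "bounded_ternary_gf (int k - 1) = F k"
  proof (rule product_recurrence_unique)
    show "bounded_ternary_gf (int 0 - 1) = F 0"
      by (simp add: F_0 bounded_ternary_gf_minus_one)
    show "bounded_ternary_gf (int (Suc k) - 1) = 1 + fps_X *
        (bounded_ternary_gf (int (Suc (Suc k)) - 1) * bounded_ternary_gf (int (Suc k) - 1) *
         bounded_ternary_gf (int k - 1))" for k
      using bounded_ternary_gf_rec[of "int k"] by (simp add: add.commute)
  qed (rule F_rec)
  then show ?thesis by (simp add: F_def u_def eval_nat_numeral)
qed

section \<open>Closed forms for X and T\<close>

lemma is_X_properties:
  assumes T: "is_T T" and X: "is_X T X"
  shows "X = fps_X * ((1 + X + X ^ 2) ^ 3 / (1 + X ^ 2) ^ 2)"
    and "T = (1 + X + X ^ 2) / (1 + X ^ 2)"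
    and "fps_to_fls X =
      fps_to_fls (1 - fps_X * T ^ 2 - fps_sqrt (1 - 2 * fps_X * T ^ 2 - 3 * fps_X ^ 2 * T ^ 4))
        / fps_to_fls (2 * fps_X * T ^ 2)"
    and "fps_to_fls X = fps_to_fls (1 - fps_sqrt (1 - 4 * (T - 1) ^ 2)) / fps_to_fls (2 * (T - 1))"
proof -
  have X0: "fps_nth X 0 = 0" and Xw: "X = fps_X * T ^ 2 * (1 + X + X ^ 2)"
    using X is_X_iff[OF T] by simp_all
  have T0: "fps_nth T 0 = 1" using T by (simp add: is_T_def)
  have X_nz: "X \<noteq> 0" using X by (simp add: is_X_def)
  note TX = is_X_T_mult[OF T X]
  have unit: "fps_nth (1 + X ^ 2) 0 \<noteq> 0" "fps_nth ((1 + X ^ 2) ^ 2) 0 \<noteq> 0"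
    by (simp_all add: X0 power2_eq_square)
  show "T = (1 + X + X ^ 2) / (1 + X ^ 2)"
    using fps_eq_divide_unit_iff[OF unit(1)] TX by simp
  have "T ^ 2 * (1 + X + X ^ 2) * (1 + X ^ 2) ^ 2 = (1 + X + X ^ 2) ^ 3"
    using TX by algebra
  then have Q: "T ^ 2 * (1 + X + X ^ 2) = (1 + X + X ^ 2) ^ 3 / (1 + X ^ 2) ^ 2"
    using fps_eq_divide_unit_iff[OF unit(2)] by simp
  show "X = fps_X * ((1 + X + X ^ 2) ^ 3 / (1 + X ^ 2) ^ 2)"
    using Xw unfolding mult.assoc Q .
  \<comment> \<open>The candidate is the quadratic formula solved for its root; the constant term 1
    fixes the sign.\<close>
  have "fps_sqrt (1 - 2 * fps_X * T ^ 2 - 3 * fps_X ^ 2 * T ^ 4) =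
      1 - fps_X * T ^ 2 - 2 * fps_X * T ^ 2 * X"
  proof (rule fps_sqrt_eqI)
    show "(1 - fps_X * T ^ 2 - 2 * fps_X * T ^ 2 * X) ^ 2 =
        1 - 2 * fps_X * T ^ 2 - 3 * fps_X ^ 2 * T ^ 4"
      using Xw by algebra
  qed (simp add: X0)
  then show "fps_to_fls X =
      fps_to_fls (1 - fps_X * T ^ 2 - fps_sqrt (1 - 2 * fps_X * T ^ 2 - 3 * fps_X ^ 2 * T ^ 4))
        / fps_to_fls (2 * fps_X * T ^ 2)"
    using T0 by (intro fps_to_fls_eq_divide) auto
  \<comment> \<open>The same argument for the quadratic equation (T - 1)(1 + X^2) = X, a
    rearrangement of \<open>TX\<close>.\<close>
  have "fps_sqrt (1 - 4 * (T - 1) ^ 2) = 1 - 2 * (T - 1) * X"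
  proof (rule fps_sqrt_eqI)
    show "(1 - 2 * (T - 1) * X) ^ 2 = 1 - 4 * (T - 1) ^ 2" using TX by algebra
  qed (simp add: X0)
  moreover have "T - 1 \<noteq> 0" using TX X_nz by auto
  ultimately show "fps_to_fls X =
      fps_to_fls (1 - fps_sqrt (1 - 4 * (T - 1) ^ 2)) / fps_to_fls (2 * (T - 1))"
    by (intro fps_to_fls_eq_divide) auto
qed

theorem theorem1:
  "(\<exists>!T. is_T T) \<and> is_T ternary_gf \<and>
   (\<forall>T. is_T T \<longrightarrow>
     (\<exists>!X. is_X T X) \<and>
     (\<forall>X. is_X T X \<longrightarrow>
        X = fps_X * ((1 + X + X ^ 2) ^ 3 / (1 + X ^ 2) ^ 2) \<and>
        T = (1 + X + X ^ 2) / (1 + X ^ 2) \<and>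
        (\<forall>n. fps_nth X n \<ge> 0) \<and>
        fps_to_fls X =
          fps_to_fls (1 - fps_X * T ^ 2 - fps_sqrt (1 - 2 * fps_X * T ^ 2 - 3 * fps_X ^ 2 * T ^ 4))
            / fps_to_fls (2 * fps_X * T ^ 2) \<and>
        fps_to_fls X =
          fps_to_fls (1 - fps_sqrt (1 - 4 * (T - 1) ^ 2)) / fps_to_fls (2 * (T - 1)) \<and>
        (\<forall>j::int. j \<ge> -1 \<longrightarrow>
          bounded_ternary_gf j =
            T * (((1 - X ^ nat (j + 2)) * (1 - X ^ nat (j + 5)))
                 / ((1 - X ^ nat (j + 3)) * (1 - X ^ nat (j + 4)))))))"
proof (intro conjI allI impI)
  show "\<exists>!T. is_T T" using is_T_ternary_gf is_T_unique by blast
  show "is_T ternary_gf" by (rule is_T_ternary_gf)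
next
  fix T assume "is_T T"
  then show "\<exists>!X. is_X T X" using is_X_exists is_X_unique by blast
next
  fix T X and j :: int
  assume T: "is_T T" and X: "is_X T X" and j: "j \<ge> -1"
  have nat: "int (nat (j + 1)) - 1 = j" "nat (j + 1) + 1 = nat (j + 2)"
    "nat (j + 1) + 2 = nat (j + 3)" "nat (j + 1) + 3 = nat (j + 4)" "nat (j + 1) + 4 = nat (j + 5)"
    using j by simp_all
  show "bounded_ternary_gf j =
      T * (((1 - X ^ nat (j + 2)) * (1 - X ^ nat (j + 5)))
           / ((1 - X ^ nat (j + 3)) * (1 - X ^ nat (j + 4))))"
    using bounded_ternary_gf_formula[OF T X, of "nat (j + 1)"] unfolding nat .
qed (fact is_X_properties is_X_nonneg)+

end
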